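(* Let $(Q,\circ,\bullet,*,/)$ be a binary algebraic structure, i.e. a set $Q$ with four binary operations $\circ,\bullet,*,/$. The following are equivalent: (i) $(Q,\circ,\bullet,*,/)$ is an oriented bondle; (ii) $(Q,\circ,*,/)$ and $(Q,\bullet,*,/)$ are oriented singquandles and $$(y*x)\bullet x=(y*(x\bullet y))\bullet x\quad\text{for all }x,y\in Q.$$
   Context: A quandle is a set $Q$ with two binary operations $*,/$ such that for all $x,y,z\in Q$: $(x*y)/y=x=(x/y)*y$, $x*x=x$, and $(x*y)*z=(x*z)*(y*z)$. An oriented singquandle is a binary algebraic structure $(Q,\cdot,*,/)$ (a set $Q$ with three binary operations) such that $(Q,*,/)$ is a quandle and the following identities hold for all $x,y,z\in Q$: (OS1') $(y\cdot x)*z=(y*z)\cdot(x*z)$; (OS2') $(x\cdot(y\cdot x))*z=(x*z)\cdot((y*z)\cdot(x*z))$; (OS3') $(y*x)*z=(y*(z\cdot x))*((x*z)\cdot z)$; (OS4') $(y\cdot x)*((x*y)\cdot y)=(y*(x*y))\cdot(x*y)$. Saying that $(Q,\circ,*,/)$ (resp. $(Q,\bullet,*,/)$) is an oriented singquandle means that these conditions hold with $\circ$ (resp. $\bullet$) in place of $\cdot$. An oriented bondle is a binary algebraic structure $(Q,\cdot,\bullet,*,/)$ such that $(Q,\cdot,*,/)$ is an oriented singquandle and the following identities hold for all $x,y,z\in Q$: (OB1') $(x\bullet y)*z=(x*z)\bullet(y*z)$; (OB3') $(z/(y\bullet x))*x=(z/y)*(x\bullet y)$; (OB4') $(y\bullet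 x)/y=y\bullet(x/(x\bullet y))$. In the claim, the operation $\circ$ plays the role of $\cdot$ in this definition. *)

theory Defs
  imports Main
begin

text \<open>An algebraic structure is a carrier set \<open>Q\<close> (possibly empty) together with operations
  on the ambient type that are closed on \<open>Q\<close>; all identities are relativised to \<open>Q\<close>.\<close>

definition binop_on :: "'a set \<Rightarrow> ('a \<Rightarrow> 'a \<Rightarrow> 'a) \<Rightarrow> bool" where
  "binop_on Q f \<longleftrightarrow> (\<forall>x\<in>Q. \<forall>y\<in>Q. f x y \<in> Q)"

locale quandle =
  fixes Q :: "'a set"
    and star :: "'a \<Rightarrow> 'a \<Rightarrow> 'a" (infixl \<open>\<star>\<close> 70)
    and slash :: "'a \<Rightarrow> 'a \<Rightarrow> 'a" (infixl \<open>\<sslash>\<close> 70)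
  assumes star_closed: "binop_on Q (\<star>)"
    and slash_closed: "binop_on Q (\<sslash>)"
    and star_slash: "x \<in> Q \<Longrightarrow> y \<in> Q \<Longrightarrow> (x \<star> y) \<sslash> y = x"
    and slash_star: "x \<in> Q \<Longrightarrow> y \<in> Q \<Longrightarrow> (x \<sslash> y) \<star> y = x"
    and star_idem: "x \<in> Q \<Longrightarrow> x \<star> x = x"
    and star_distrib: "x \<in> Q \<Longrightarrow> y \<in> Q \<Longrightarrow> z \<in> Q \<Longrightarrow>
      (x \<star> y) \<star> z = (x \<star> z) \<star> (y \<star> z)"

locale oriented_singquandle = quandle Q star slash
  for Q :: "'a set"
    and dot :: "'a \<Rightarrow> 'a \<Rightarrow> 'a" (infixl \<open>\<cdot>\<close> 70)
    and star :: "'a \<Rightarrow> 'a \<Rightarrow> 'a" (infixl \<open>\<star>\<close> 70)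
    and slash :: "'a \<Rightarrow> 'a \<Rightarrow> 'a" (infixl \<open>\<sslash>\<close> 70) +
  assumes dot_closed: "binop_on Q (\<cdot>)"
    and OS1: "x \<in> Q \<Longrightarrow> y \<in> Q \<Longrightarrow> z \<in> Q \<Longrightarrow>
      (y \<cdot> x) \<star> z = (y \<star> z) \<cdot> (x \<star> z)"
    and OS2: "x \<in> Q \<Longrightarrow> y \<in> Q \<Longrightarrow> z \<in> Q \<Longrightarrow>
      (x \<cdot> (y \<cdot> x)) \<star> z = (x \<star> z) \<cdot> ((y \<star> z) \<cdot> (x \<star> z))"
    and OS3: "x \<in> Q \<Longrightarrow> y \<in> Q \<Longrightarrow> z \<in> Q \<Longrightarrow>
      (y \<star> x) \<star> z = (y \<star> (z \<cdot> x)) \<star> ((x \<star> z) \<cdot> z)"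
    and OS4: "x \<in> Q \<Longrightarrow> y \<in> Q \<Longrightarrow>
      (y \<cdot> x) \<star> ((x \<star> y) \<cdot> y) = (y \<star> (x \<star> y)) \<cdot> (x \<star> y)"

locale oriented_bondle = oriented_singquandle Q dot star slash
  for Q :: "'a set"
    and dot :: "'a \<Rightarrow> 'a \<Rightarrow> 'a" (infixl \<open>\<cdot>\<close> 70)
    and bullet :: "'a \<Rightarrow> 'a \<Rightarrow> 'a" (infixl \<open>\<bullet>\<close> 70)
    and star :: "'a \<Rightarrow> 'a \<Rightarrow> 'a" (infixl \<open>\<star>\<close> 70)
    and slash :: "'a \<Rightarrow> 'a \<Rightarrow> 'a" (infixl \<open>\<sslash>\<close> 70) +
  assumes bullet_closed: "binop_on Q (\<bullet>)"
    and OB1: "x \<in> Q \<Longrightarrow> y \<in> Q \<Longrightarrow> z \<in> Q \<Longrightarrow>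
      (x \<bullet> y) \<star> z = (x \<star> z) \<bullet> (y \<star> z)"
    and OB3: "x \<in> Q \<Longrightarrow> y \<in> Q \<Longrightarrow> z \<in> Q \<Longrightarrow>
      (z \<sslash> (y \<bullet> x)) \<star> x = (z \<sslash> y) \<star> (x \<bullet> y)"
    and OB4: "x \<in> Q \<Longrightarrow> y \<in> Q \<Longrightarrow>
      (y \<bullet> x) \<sslash> y = y \<bullet> (x \<sslash> (x \<bullet> y))"

end

theory Submission imports Defs begin

text \<open>Write \<open>R\<^sub>a\<close> for right translation by \<open>a\<close>, composed from left to right. Given (OS1'), \<open>(x \<star> z) \<bullet> z = (x \<bullet> z) \<star> z\<close>,
  and \<open>R\<close> of \<open>a \<star> z\<close> is the conjugate of \<open>R\<^sub>a\<close> by \<open>R\<^sub>z\<close>; cancelling the common final \<open>R\<^sub>z\<close> turns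
  (OS3') into (OB3'), and (OS4') into \<open>((y \<bullet> x) \<sslash> y) \<star> (x \<bullet> y) = (y \<star> x) \<bullet> x\<close>. This last identity is
  (OB3') at \<open>z = y \<bullet> x\<close>, and applying \<open>R\<close> of \<open>x \<bullet> y\<close> to (OB4') gives the same left-hand side
  with right-hand side \<open>(y \<star> (x \<bullet> y)) \<bullet> x\<close>.\<close>

context quandle
begin

lemma star_in [simp]: "x \<in> Q \<Longrightarrow> y \<in> Q \<Longrightarrow> x \<star> y \<in> Q"
  using star_closed by (simp add: binop_on_def)

lemma slash_in [simp]: "x \<in> Q \<Longrightarrow> y \<in> Q \<Longrightarrow> x \<sslash> y \<in> Q"
  using slash_closed by (simp add: binop_on_def)

lemma star_cancel: "x \<in> Q \<Longrightarrow> y \<in> Q \<Longrightarrow> z \<in> Q \<Longrightarrow> x \<star> z = y \<star> z \<longleftrightarrow> x = y"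
  by (metis star_slash)

text \<open>Distributivity at \<open>x \<sslash> z\<close>; the point is to expose a final
  \<open>\<star> z\<close> that \<open>star_cancel\<close> can remove.\<close>

lemma slash_star_distrib:
  assumes "x \<in> Q" "y \<in> Q" "z \<in> Q"
  shows "x \<star> (y \<star> z) = ((x \<sslash> z) \<star> y) \<star> z"
  using assms by (simp add: star_distrib slash_star)

end

text \<open>(OB1') and (OS1') for \<open>\<bullet>\<close> agree up to renaming, so both directions
  of the theorem can interpret this common core.\<close>

locale quandle_distrib_op = quandle Q star slash
  for Q :: "'a set"
    and bullet :: "'a \<Rightarrow> 'a \<Rightarrow> 'a" (infixl \<open>\<bullet>\<close> 70)
    and star :: "'a \<Rightarrow> 'a \<Rightarrow> 'a" (infixl \<open>\<star>\<close> 70)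
    and slash :: "'a \<Rightarrow> 'a \<Rightarrow> 'a" (infixl \<open>\<sslash>\<close> 70) +
  assumes bullet_closed: "binop_on Q (\<bullet>)"
    and bullet_star: "x \<in> Q \<Longrightarrow> y \<in> Q \<Longrightarrow> z \<in> Q \<Longrightarrow>
      (x \<bullet> y) \<star> z = (x \<star> z) \<bullet> (y \<star> z)"
begin

lemma bullet_in [simp]: "x \<in> Q \<Longrightarrow> y \<in> Q \<Longrightarrow> x \<bullet> y \<in> Q"
  using bullet_closed by (simp add: binop_on_def)

lemma star_bullet_self: "x \<in> Q \<Longrightarrow> z \<in> Q \<Longrightarrow> (x \<star> z) \<bullet> z = (x \<bullet> z) \<star> z"
  by (simp add: bullet_star star_idem)

text \<open>After cancelling \<open>z\<close>, what remains is (OB3') for the pair \<open>x\<close>,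
  \<open>z\<close> at the element \<open>y \<star> (z \<bullet> x)\<close>, its left side already
  simplified to \<open>y \<star> x\<close>.\<close>

lemma OS3_iff:
  assumes "x \<in> Q" "y \<in> Q" "z \<in> Q"
  shows "(y \<star> x) \<star> z = (y \<star> (z \<bullet> x)) \<star> ((x \<star> z) \<bullet> z) \<longleftrightarrow>
    y \<star> x = ((y \<star> (z \<bullet> x)) \<sslash> z) \<star> (x \<bullet> z)"
  using assms by (simp add: star_bullet_self slash_star_distrib star_cancel)

text \<open>Right translation by \<open>y \<bullet> x\<close> permutes \<open>Q\<close>, so
  \<open>z = w \<star> (y \<bullet> x)\<close> runs through \<open>Q\<close> as \<open>w\<close>
  does. Hence the equivalence holds for each fixed pair \<open>x\<close>, \<open>y\<close>.\<close>

lemma OS3_iff_OB3: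
  assumes "x \<in> Q" "y \<in> Q"
  shows "(\<forall>w\<in>Q. (w \<star> x) \<star> y = (w \<star> (y \<bullet> x)) \<star> ((x \<star> y) \<bullet> y)) \<longleftrightarrow>
    (\<forall>z\<in>Q. (z \<sslash> (y \<bullet> x)) \<star> x = (z \<sslash> y) \<star> (x \<bullet> y))" (is "?OS3 \<longleftrightarrow> ?OB3")
proof
  assume os: ?OS3
  show ?OB3
  proof
    fix z assume "z \<in> Q"
    then have "z \<sslash> (y \<bullet> x) \<in> Q" and "(z \<sslash> (y \<bullet> x)) \<star> (y \<bullet> x) = z"
      using assms by (simp_all add: slash_star)
    with os OS3_iff assms show "(z \<sslash> (y \<bullet> x)) \<star> x = (z \<sslash> y) \<star> (x \<bullet> y)"
      by metis
  qed
next
  assume ob: ?OB3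
  show ?OS3
  proof
    fix w assume w: "w \<in> Q"
    then have "w \<star> (y \<bullet> x) \<in> Q" and "(w \<star> (y \<bullet> x)) \<sslash> (y \<bullet> x) = w"
      using assms by (simp_all add: star_slash)
    with ob OS3_iff assms w show "(w \<star> x) \<star> y = (w \<star> (y \<bullet> x)) \<star> ((x \<star> y) \<bullet> y)"
      by metis
  qed
qed

lemma OS4_iff:
  assumes "x \<in> Q" "y \<in> Q"
  shows "(y \<bullet> x) \<star> ((x \<star> y) \<bullet> y) = (y \<star> (x \<star> y)) \<bullet> (x \<star> y) \<longleftrightarrow>
    ((y \<bullet> x) \<sslash> y) \<star> (x \<bullet> y) = (y \<star> x) \<bullet> x"
proof -
  \<comment> \<open>Distribute on the right and use \<open>y \<star> y = y\<close>.\<close>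
  have "y \<star> (x \<star> y) = (y \<star> x) \<star> y"
    using assms by (simp add: star_distrib star_idem)
  then have "(y \<star> (x \<star> y)) \<bullet> (x \<star> y) = ((y \<star> x) \<bullet> x) \<star> y"
    using assms by (simp add: bullet_star)
  moreover have "(y \<bullet> x) \<star> ((x \<star> y) \<bullet> y) = (((y \<bullet> x) \<sslash> y) \<star> (x \<bullet> y)) \<star> y"
    using assms by (simp add: star_bullet_self slash_star_distrib)
  ultimately show ?thesis
    using assms by (simp add: star_cancel)
qed

lemma OB4_iff:
  assumes "\<And>x y. x \<in> Q \<Longrightarrow> y \<in> Q \<Longrightarrow> ((y \<bullet> x) \<sslash> y) \<star> (x \<bullet> y) = (y \<star> x) \<bullet> x"
    and xy: "x \<in> Q" "y \<in> Q"
  shows "(y \<bullet> x) \<sslash> y = y \<bullet> (x \<sslash> (x \<bullet> y)) \<longleftrightarrow>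
    (y \<star> x) \<bullet> x = (y \<star> (x \<bullet> y)) \<bullet> x"
proof -
  \<comment> \<open>Distributing over \<open>\<bullet>\<close> undoes the division in the second
    argument.\<close>
  have "(y \<bullet> (x \<sslash> (x \<bullet> y))) \<star> (x \<bullet> y) = (y \<star> (x \<bullet> y)) \<bullet> x"
    using xy by (simp add: bullet_star slash_star)
  with assms(1)[OF xy] star_cancel[of "(y \<bullet> x) \<sslash> y" "y \<bullet> (x \<sslash> (x \<bullet> y))" "x \<bullet> y"] xy
  show ?thesis
    by simp
qed

lemma OB3_imp_OS4:
  assumes "\<And>z. z \<in> Q \<Longrightarrow> (z \<sslash> (y \<bullet> x)) \<star> x = (z \<sslash> y) \<star> (x \<bullet> y)"
    and xy: "x \<in> Q" "y \<in> Q"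
  shows "((y \<bullet> x) \<sslash> y) \<star> (x \<bullet> y) = (y \<star> x) \<bullet> x"
proof -
  \<comment> \<open>Idempotence passes to division, so the left side of (OB3') becomes
    \<open>(y \<bullet> x) \<star> x\<close>.\<close>
  have "(y \<bullet> x) \<sslash> (y \<bullet> x) = y \<bullet> x"
    using xy bullet_in by (metis star_idem star_slash)
  with assms(1)[of "y \<bullet> x"] xy show ?thesis
    by (simp add: bullet_star star_idem)
qed

text \<open>(OS2') is distributivity applied twice, (OS3') is a reparametrised (OB3'), and (OS4')
  follows from (OB3').\<close>

lemma oriented_singquandle_iff:
  "oriented_singquandle Q (\<bullet>) (\<star>) (\<sslash>) \<longleftrightarrow>
    (\<forall>x\<in>Q. \<forall>y\<in>Q. \<forall>z\<in>Q. (z \<sslash> (y \<bullet> x)) \<star> x = (z \<sslash> y) \<star> (x \<bullet> y))"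
  (is "?singquandle \<longleftrightarrow> ?OB3")
proof
  assume ?singquandle
  then interpret oriented_singquandle Q "(\<bullet>)" "(\<star>)" "(\<sslash>)" .
  show ?OB3
  proof (intro ballI)
    fix x y z assume "x \<in> Q" "y \<in> Q" "z \<in> Q"
    with OS3_iff_OB3[of x y] OS3 show "(z \<sslash> (y \<bullet> x)) \<star> x = (z \<sslash> y) \<star> (x \<bullet> y)"
      by blast
  qed
next
  assume ob3: ?OB3
  show ?singquandle
  proof
    fix x y z assume *: "x \<in> Q" "y \<in> Q" "z \<in> Q"
    then show "(x \<bullet> (y \<bullet> x)) \<star> z = (x \<star> z) \<bullet> ((y \<star> z) \<bullet> (x \<star> z))"
      by (simp add: bullet_star)
    \<comment> \<open>Here \<open>z\<close> is the second member of the fixed pair and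
      \<open>y\<close> is the quantified \<open>w\<close>.\<close>
    from * ob3 OS3_iff_OB3[of x z]
    show "(y \<star> x) \<star> z = (y \<star> (z \<bullet> x)) \<star> ((x \<star> z) \<bullet> z)"
      by blast
  next
    fix x y assume "x \<in> Q" "y \<in> Q"
    with ob3 OB3_imp_OS4 OS4_iff
    show "(y \<bullet> x) \<star> ((x \<star> y) \<bullet> y) = (y \<star> (x \<star> y)) \<bullet> (x \<star> y)"
      by metis
  qed (simp_all add: bullet_closed bullet_star)
qed

end

theorem theorem1p9:
  fixes Q :: "'a set"
    and circ :: "'a \<Rightarrow> 'a \<Rightarrow> 'a" (infixl \<open>\<odot>\<close> 70)
    and bullet :: "'a \<Rightarrow> 'a \<Rightarrow> 'a" (infixl \<open>\<bullet>\<close> 70)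
    and star :: "'a \<Rightarrow> 'a \<Rightarrow> 'a" (infixl \<open>\<star>\<close> 70)
    and slash :: "'a \<Rightarrow> 'a \<Rightarrow> 'a" (infixl \<open>\<sslash>\<close> 70)
  assumes "binop_on Q (\<odot>)" and "binop_on Q (\<bullet>)"
    and "binop_on Q (\<star>)" and "binop_on Q (\<sslash>)"
  shows "oriented_bondle Q (\<odot>) (\<bullet>) (\<star>) (\<sslash>) \<longleftrightarrow>
    oriented_singquandle Q (\<odot>) (\<star>) (\<sslash>) \<and>
    oriented_singquandle Q (\<bullet>) (\<star>) (\<sslash>) \<and>
    (\<forall>x\<in>Q. \<forall>y\<in>Q. (y \<star> x) \<bullet> x = (y \<star> (x \<bullet> y)) \<bullet> x)"
proof
  assume "oriented_bondle Q (\<odot>) (\<bullet>) (\<star>) (\<sslash>)"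
  then interpret oriented_bondle Q "(\<odot>)" "(\<bullet>)" "(\<star>)" "(\<sslash>)" .
  interpret quandle_distrib_op Q "(\<bullet>)" "(\<star>)" "(\<sslash>)"
    by unfold_locales (use bullet_closed OB1 in auto)
  have "oriented_singquandle Q (\<bullet>) (\<star>) (\<sslash>)"
    using oriented_singquandle_iff OB3 by blast
  moreover have "\<forall>x\<in>Q. \<forall>y\<in>Q. (y \<star> x) \<bullet> x = (y \<star> (x \<bullet> y)) \<bullet> x"
    \<comment> \<open>(OB3') discharges the premise of \<open>OB4_iff\<close>, which then trades
      (OB4') for the extra identity.\<close>
    using OB4_iff[OF OB3_imp_OS4] OB3 OB4 by blast
  ultimately show "oriented_singquandle Q (\<odot>) (\<star>) (\<sslash>) \<and>
    oriented_singquandle Q (\<bullet>) (\<star>) (\<sslash>) \<and>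
    (\<forall>x\<in>Q. \<forall>y\<in>Q. (y \<star> x) \<bullet> x = (y \<star> (x \<bullet> y)) \<bullet> x)"
    using oriented_singquandle_axioms by blast
next
  assume sing: "oriented_singquandle Q (\<odot>) (\<star>) (\<sslash>) \<and>
    oriented_singquandle Q (\<bullet>) (\<star>) (\<sslash>) \<and>
    (\<forall>x\<in>Q. \<forall>y\<in>Q. (y \<star> x) \<bullet> x = (y \<star> (x \<bullet> y)) \<bullet> x)"
  interpret circ: oriented_singquandle Q "(\<odot>)" "(\<star>)" "(\<sslash>)"
    using sing by blast
  interpret bullet: oriented_singquandle Q "(\<bullet>)" "(\<star>)" "(\<sslash>)"
    using sing by blast
  interpret quandle_distrib_op Q "(\<bullet>)" "(\<star>)" "(\<sslash>)"
    by unfold_locales (use bullet.dot_closed bullet.OS1 in auto)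
  have ob3: "\<And>x y z. x \<in> Q \<Longrightarrow> y \<in> Q \<Longrightarrow> z \<in> Q \<Longrightarrow>
      (z \<sslash> (y \<bullet> x)) \<star> x = (z \<sslash> y) \<star> (x \<bullet> y)"
    using oriented_singquandle_iff sing by blast
  show "oriented_bondle Q (\<odot>) (\<bullet>) (\<star>) (\<sslash>)"
  proof
    fix x y assume "x \<in> Q" "y \<in> Q"
    then show "(y \<bullet> x) \<sslash> y = y \<bullet> (x \<sslash> (x \<bullet> y))"
      \<comment> \<open>The same equivalence read backwards, with (OB3') recovered from the
        \<open>\<bullet>\<close> singquandle.\<close>
      using OB4_iff[OF OB3_imp_OS4] ob3 sing by blast
  qed (use bullet_closed bullet_star ob3 in auto)
qed

end
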